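(* Let $X$ be a Banach space and let $\mu \in \mathcal{M}$. Then $(PAA(\mathbb{R},X,\mu), \Vert \cdot \Vert_{\infty})$ is a Banach space.
   Context: $\mathcal{B}$ denotes the Lebesgue $\sigma$-field of $\mathbb{R}$ and $\mathcal{M}$ the set of all positive measures $\mu$ on $\mathcal{B}$ satisfying $\mu(\mathbb{R}) = +\infty$ and $\mu([a,b]) < +\infty$ for all $a,b \in \mathbb{R}$ with $a \leq b$. $BC(\mathbb{R},X)$ is the Banach space of all continuous bounded functions from $\mathbb{R}$ to $X$, with norm $\Vert f \Vert_{\infty} = \sup_{t \in \mathbb{R}} \Vert f(t) \Vert$. A continuous function $f : \mathbb{R} \to X$ is almost automorphic if for every sequence of real numbers $(s_n')_n$ there exists a subsequence $(s_n)_n$ of $(s_n')_n$ such that $g(t) = \lim_{n \to \infty} f(t+s_n)$ exists for all $t \in \mathbb{R}$ and $\lim_{n \to \infty} g(t-s_n) = f(t)$ for all $t \in \mathbb{R}$ (limits in the norm of $X$). $AA(\mathbb{R},X)$ denotes the space of all such functions (which are bounded). For $\mu \in \mathcal{M}$, a function $f \in BC(\mathbb{R},X)$ is $\mu$-ergodic if $\lim_{r \to +\infty} \frac{1}{\mu([-r,r])} \int_{[-r,r]} \Vert f(t) \Vert \, d\mu(t) = 0$. $\mathcal{E}(\mathbb{R},X,\mu)$ denotes the space of all such functions. A function $f \in BC(\mathbb{R},X)$ is $\mu$-pseudo almost automorphic if $f = g + \phi$ with $g \in AA(\mathbb{R},X)$ and $\phi \in \mathcal{E}(\mathbb{R},X,\mu)$.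 $PAA(\mathbb{R},X,\mu)$ denotes the space of all such functions (the sum is not direct in general). *)

theory Defs
  imports "HOL-Analysis.Analysis"
begin

definition measure_class :: "real measure set" where
  "measure_class = {M. sets M = sets lebesgue \<and> emeasure M UNIV = \<infinity> \<and>
     (\<forall>a b. a \<le> b \<longrightarrow> emeasure M {a..b} < \<infinity>)}"

definition AA :: "(real \<Rightarrow> 'a::real_normed_vector) set" where
  "AA = {f. continuous_on UNIV f \<and>
     (\<forall>s' :: nat \<Rightarrow> real. \<exists>\<sigma> :: nat \<Rightarrow> nat. strict_mono \<sigma> \<and>
       (\<exists>g :: real \<Rightarrow> 'a. \<forall>t.
          (\<lambda>n. f (t + s' (\<sigma> n))) \<longlonglongrightarrow> g t \<and>
          (\<lambda>n. g (t - s' (\<sigma> n))) \<longlonglongrightarrow> f t))}"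

(* The quotient is 0 (division by zero) when M {-r..r} = 0; for M in measure_class this
   happens at most for small r, so it does not affect the limit. *)
definition ergodic :: "real measure \<Rightarrow> (real \<Rightarrow> 'a::real_normed_vector) set" where
  "ergodic M = {f \<in> bcontfun.
     ((\<lambda>r. (1 / measure M {-r..r}) * (LINT t:{-r..r}|M. norm (f t))) \<longlongrightarrow> 0) at_top}"

(* PAA is a subset of the library type of bounded continuous functions, whose norm is
   the supremum norm. *)
definition PAA :: "real measure \<Rightarrow> (real \<Rightarrow>\<^sub>C 'a::real_normed_vector) set" where
  "PAA M = {f. \<exists>g \<phi>. g \<in> AA \<and> \<phi> \<in> ergodic M \<and>
     apply_bcontfun f = (\<lambda>t. g t + \<phi> t)}"

end

(* The sum AA + E need not be direct, so closedness has to come from a good choice of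
   decompositions. Let f = g + \<phi> with c = \<parallel>f\<parallel> and let T be the radial truncation of X onto the
   ball of radius c. Since T is continuous, T o g is almost automorphic; since
   |g| \<le> c + |\<phi>|, the error g - T o g is dominated by |\<phi>| and hence ergodic. So f can be
   decomposed with an almost automorphic part of norm at most \<parallel>f\<parallel>, and summing such
   decompositions of a rapidly convergent telescoping series shows that AA + E is closed,
   because AA and E are. *)

theory Submission
  imports Defs "HOL-Library.Diagonal_Subsequence"
begin

section \<open>Sums of closed subspaces\<close>

text \<open>Sums of closed subspaces need not be closed in general. The bound on the
  \<open>A\<close>-part in \<open>dec\<close> is what rescues closedness: it makes the
  \<open>A\<close>-parts of an absolutely convergent series absolutely summable.\<close>

lemma closed_sum_of_closed_subspaces:
  fixes A B :: "'b::banach set"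
  assumes A: "subspace A" "closed A" and B: "subspace B" "closed B"
    and dec: "\<And>f. f \<in> {x + y |x y. x \<in> A \<and> y \<in> B} \<Longrightarrow> \<exists>g\<in>A. f - g \<in> B \<and> norm g \<le> norm f"
  shows "closed {x + y |x y. x \<in> A \<and> y \<in> B}"
proof -
  define S where "S = {x + y |x y. x \<in> A \<and> y \<in> B}"
  have S: "subspace S"
    unfolding S_def using A B by (intro subspace_sums)
  have sum_in: "x + y \<in> S" if "x \<in> A" "y \<in> B" for x y
    using that unfolding S_def by blast
  have split: "\<exists>g\<in>A. f - g \<in> B \<and> norm g \<le> norm f" if "f \<in> S" for f
    using dec that unfolding S_def .
  have "l \<in> S" if s: "\<forall>n. s n \<in> S" and l: "s \<longlonglongrightarrow> l" for s l
  proof -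
    \<comment> \<open>The given sequence may converge too slowly for its increments to be summable
      in norm, so it is replaced by one with a geometric rate.\<close>
    have "\<exists>f\<in>S. dist f l < (1/2)^n" for n :: nat
    proof -
      have "eventually (\<lambda>k. dist (s k) l < (1/2)^n) sequentially"
        using l by (intro tendstoD) auto
      then show ?thesis
        using s by (meson eventually_happens trivial_limit_sequentially)
    qed
    then obtain f where f: "\<And>n. f n \<in> S" "\<And>n. dist (f n) l < (1/2)^n"
      by metis
    have fl: "f \<longlonglongrightarrow> l"
    proof (rule metric_LIMSEQ_I)
      fix e :: real assume "e > 0"
      then obtain N where N: "(1/2)^N < e"
        using real_arch_pow_inv[of e "1/2"] by auto
      have "dist (f n) l < e" if "n \<ge> N" for n
      proof -
        have "(1/2::real)^n \<le> (1/2)^N" using that by (intro power_decreasing) auto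
        then show ?thesis using f(2)[of n] N by linarith
      qed
      then show "\<exists>N. \<forall>n\<ge>N. dist (f n) l < e" by blast
    qed
    define u where "u n = f (Suc n) - f n" for n
    have u_sums: "u sums (l - f 0)"
      unfolding u_def by (rule telescope_sums[OF fl])
    have u_norm: "norm (u n) \<le> 2 * (1/2)^n" for n
    proof -
      have "norm (u n) \<le> dist (f (Suc n)) l + dist (f n) l"
        unfolding u_def dist_norm[symmetric] by (rule dist_triangle2)
      also have "\<dots> \<le> (1/2)^Suc n + (1/2)^n"
        using f(2)[of n] f(2)[of "Suc n"] by linarith
      also have "\<dots> \<le> 2 * (1/2)^n" by simp
      finally show ?thesis .
    qed
    have "\<exists>g\<in>A. u n - g \<in> B \<and> norm g \<le> norm (u n)" for n
      unfolding u_def using S f(1) by (intro split subspace_diff)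
    then obtain g where g: "\<And>n. g n \<in> A" "\<And>n. u n - g n \<in> B" "\<And>n. norm (g n) \<le> norm (u n)"
      by metis
    have "summable g"
    proof (rule summable_comparison_test')
      show "summable (\<lambda>n. 2 * (1/2::real)^n)" by (intro summable_mult summable_geometric) auto
      show "norm (g n) \<le> 2 * (1/2)^n" for n using g(3)[of n] u_norm[of n] by linarith
    qed
    then have g_sums: "g sums suminf g" by (rule summable_sums)
    have "(\<Sum>i<n. g i) \<in> A" for n
      using A(1) g(1) by (intro subspace_sum)
    then have "suminf g \<in> A"
      by (rule closed_sequentially[OF A(2) _ g_sums[unfolded sums_def]])
    moreover have "(\<Sum>i<n. u i - g i) \<in> B" for n
      using B(1) g(2) by (intro subspace_sum)
    \<comment> \<open>The \<open>B\<close>-parts need no estimate of their own: their partial sums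
      converge as differences of the telescoping sums and the sums of \<open>g\<close>.\<close>
    then have "(l - f 0) - suminf g \<in> B"
      by (rule closed_sequentially[OF B(2) _ sums_diff[OF u_sums g_sums, unfolded sums_def]])
    ultimately have "suminf g + ((l - f 0) - suminf g) \<in> S" by (rule sum_in)
    then have "(l - f 0) + f 0 \<in> S"
      using S f(1)[of 0] by (intro subspace_add) auto
    then show "l \<in> S" by simp
  qed
  then show ?thesis
    unfolding closed_sequential_limits S_def[symmetric] by blast
qed

section \<open>Almost automorphic functions\<close>

text \<open>Sequence and limit function are made explicit here, since the arguments below refine a
  sequence repeatedly while keeping the limits already found.\<close>

definition aa_along :: "(nat \<Rightarrow> real) \<Rightarrow> (real \<Rightarrow> 'a::real_normed_vector) \<Rightarrow> (real \<Rightarrow> 'a) \<Rightarrow> bool" where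
  "aa_along s f g \<longleftrightarrow>
     (\<forall>t. (\<lambda>n. f (t + s n)) \<longlonglongrightarrow> g t \<and> (\<lambda>n. g (t - s n)) \<longlonglongrightarrow> f t)"

lemma AA_iff:
  "f \<in> AA \<longleftrightarrow> continuous_on UNIV f \<and>
     (\<forall>s :: nat \<Rightarrow> real. \<exists>\<sigma>. strict_mono \<sigma> \<and> (\<exists>g. aa_along (s \<circ> \<sigma>) f g))"
  by (simp add: AA_def aa_along_def)

lemma aa_along_subseq:
  "aa_along s f g \<Longrightarrow> strict_mono r \<Longrightarrow> aa_along (s \<circ> r) f g"
  unfolding aa_along_def
  using LIMSEQ_subseq_LIMSEQ[of "\<lambda>n. f (_ + s n)" _ r]
    LIMSEQ_subseq_LIMSEQ[of "\<lambda>n. g (_ - s n)" _ r]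
  by (simp add: o_def)

lemma AA_continuous: "f \<in> AA \<Longrightarrow> continuous_on UNIV f"
  by (simp add: AA_iff)

text \<open>Continuity of \<open>T\<close> carries both pointwise limits over along the same
  subsequence, with \<open>T\<close> applied to the old limit function. It serves both scalar
  multiples and the truncation.\<close>

lemma AA_compose:
  assumes f: "f \<in> AA" and T: "continuous_on UNIV T"
  shows "(\<lambda>t. T (f t)) \<in> AA"
proof -
  have lim: "(\<lambda>n. T (x n)) \<longlonglongrightarrow> T y" if "x \<longlonglongrightarrow> y" for x y
    using continuous_on_tendsto_compose[OF T that] by simp
  show ?thesis
    unfolding AA_iff
  proof (intro conjI allI)
    show "continuous_on UNIV (\<lambda>t. T (f t))"
      by (rule continuous_on_compose2[OF T AA_continuous[OF f]]) simp
    fix s :: "nat \<Rightarrow> real"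
    obtain \<sigma> g where "strict_mono \<sigma>" "aa_along (s \<circ> \<sigma>) f g"
      using f unfolding AA_iff by blast
    then show "\<exists>\<sigma>. strict_mono \<sigma> \<and> (\<exists>g. aa_along (s \<circ> \<sigma>) (\<lambda>t. T (f t)) g)"
      by (intro exI[of _ \<sigma>] conjI exI[of _ "\<lambda>t. T (g t)"]) (auto simp: aa_along_def lim)
  qed
qed

lemma AA_add:
  assumes f: "f \<in> AA" and g: "g \<in> AA"
  shows "(\<lambda>t. f t + g t) \<in> AA"
  unfolding AA_iff
proof (intro conjI allI)
  show "continuous_on UNIV (\<lambda>t. f t + g t)"
    using f g by (intro continuous_on_add AA_continuous)
  fix s :: "nat \<Rightarrow> real"
  obtain \<sigma> f' where 1: "strict_mono \<sigma>" "aa_along (s \<circ> \<sigma>) f f'"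
    using f unfolding AA_iff by blast
  \<comment> \<open>The second extraction starts from the sequence already refined for
    \<open>f\<close>, so both functions have limits along the result.\<close>
  obtain \<tau> g' where 2: "strict_mono \<tau>" "aa_along ((s \<circ> \<sigma>) \<circ> \<tau>) g g'"
    using g unfolding AA_iff by blast
  have "aa_along (s \<circ> (\<sigma> \<circ> \<tau>)) (\<lambda>t. f t + g t) (\<lambda>t. f' t + g' t)"
    using aa_along_subseq[OF 1(2) 2(1)] 2(2)
    by (auto simp: aa_along_def o_assoc intro!: tendsto_add)
  then show "\<exists>\<sigma>. strict_mono \<sigma> \<and> (\<exists>h. aa_along (s \<circ> \<sigma>) (\<lambda>t. f t + g t) h)"
    using 1(1) 2(1) strict_mono_o by blast
qed

lemma AA_const: "(\<lambda>t. c) \<in> AA"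
  unfolding AA_iff aa_along_def
  by (auto intro!: exI[of _ id] exI[of _ "\<lambda>t. c"] simp: strict_mono_def)

text \<open>If norm (\<open>f\<close> (\<open>s\<close> n)) exceeded n for every n, a subsequence of
  the translates by \<open>s\<close>, evaluated at 0, would be both convergent and
  unbounded.\<close>

lemma AA_bcontfun:
  assumes f: "f \<in> AA"
  shows "f \<in> bcontfun"
proof -
  have "bounded (range f)"
  proof (rule ccontr)
    assume "\<not> bounded (range f)"
    then have "\<exists>t. norm (f t) > real n" for n
      unfolding bounded_iff by (metis not_le rangeE)
    then obtain s where s: "\<And>n. norm (f (s n)) > real n" by metis
    obtain \<sigma> g where \<sigma>: "strict_mono \<sigma>" "aa_along (s \<circ> \<sigma>) f g"
      using f unfolding AA_iff by blast
    then have "(\<lambda>n. f (s (\<sigma> n))) \<longlonglongrightarrow> g 0"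
      by (auto simp: aa_along_def dest: spec[of _ 0])
    then have "Bseq (\<lambda>n. f (s (\<sigma> n)))"
      by (intro convergent_imp_Bseq convergentI)
    then obtain K where K: "\<And>n. norm (f (s (\<sigma> n))) \<le> K"
      unfolding Bseq_def by blast
    obtain n where "real n > K" using reals_Archimedean2 by blast
    moreover have "n \<le> \<sigma> n" using \<sigma>(1) by (rule seq_suble)
    ultimately show False using s[of "\<sigma> n"] K[of n] by linarith
  qed
  then show ?thesis using f by (simp add: bcontfun_def AA_continuous)
qed

text \<open>Uniform convergence over all times is read along the moving points
  \<open>t + s k\<close> or \<open>t - s k\<close>, the form in which
  \<open>swap_uniform_limit'\<close> is applied.\<close>

lemma uniform_limit_reindex:
  assumes "uniform_limit UNIV f l F"
  shows "uniform_limit UNIV (\<lambda>n k. f n (p k)) (\<lambda>k. l (p k)) F"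
  unfolding uniform_limit_iff
proof (intro allI impI)
  fix e :: real assume "e > 0"
  with assms have "\<forall>\<^sub>F n in F. \<forall>x. dist (f n x) (l x) < e"
    by (simp add: uniform_limit_iff)
  then show "\<forall>\<^sub>F n in F. \<forall>k\<in>UNIV. dist (f n (p k)) (l (p k)) < e"
    by (rule eventually_mono) blast
qed

text \<open>A diagonal sequence serves all terms at once; the limits of the translates are then
  uniformly Cauchy in the index, so both limits can be interchanged.\<close>

lemma AA_uniform_limit:
  fixes f :: "nat \<Rightarrow> real \<Rightarrow> 'a::banach"
  assumes f: "\<And>n. f n \<in> AA" and lim: "uniform_limit UNIV f l sequentially"
  shows "l \<in> AA"
  unfolding AA_iff
proof (intro conjI allI)
  show "continuous_on UNIV l"
    using f by (intro uniform_limit_theorem[OF _ lim]) (simp_all add: AA_continuous)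
  fix s :: "nat \<Rightarrow> real"
  interpret subseqs "\<lambda>n \<sigma>. \<exists>g. aa_along (s \<circ> \<sigma>) (f n) g"
  proof
    fix n and \<tau> :: "nat \<Rightarrow> nat"
    assume "strict_mono \<tau>"
    then show "\<exists>r. strict_mono r \<and> (\<exists>g. aa_along (s \<circ> (\<tau> \<circ> r)) (f n) g)"
      using f[of n] unfolding AA_iff o_assoc by blast
  qed
  have "\<exists>g. aa_along (s \<circ> diagseq) (f n) g" for n
  proof -
    have "\<exists>g. aa_along (s \<circ> (diagseq \<circ> (+) (Suc n))) (f n) g"
    proof (rule diagseq_holds)
      fix r \<tau> :: "nat \<Rightarrow> nat" and k
      assume "strict_mono r" "\<exists>g. aa_along (s \<circ> \<tau>) (f k) g"
      then show "\<exists>g. aa_along (s \<circ> (\<tau> \<circ> r)) (f k) g"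
        unfolding o_assoc using aa_along_subseq by blast
    qed
    then obtain g where g: "aa_along (s \<circ> (diagseq \<circ> (+) (Suc n))) (f n) g" ..
    \<comment> \<open>The diagonal sequence is controlled for the n-th function only from index
      \<open>Suc n\<close> on; the finitely many earlier terms do not affect the limits.\<close>
    have "(\<lambda>k. f n (t + s (diagseq k))) \<longlonglongrightarrow> g t \<and> (\<lambda>k. g (t - s (diagseq k))) \<longlonglongrightarrow> f n t" for t
      using g LIMSEQ_offset[of "\<lambda>k. f n (t + s (diagseq k))" "Suc n" "g t"]
        LIMSEQ_offset[of "\<lambda>k. g (t - s (diagseq k))" "Suc n" "f n t"]
      by (simp add: aa_along_def o_def add.commute)
    then show ?thesis by (auto simp: aa_along_def)
  qed
  then obtain g where g: "\<And>n. aa_along (s \<circ> diagseq) (f n) (g n)" by metis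
  let ?s = "s \<circ> diagseq"
  \<comment> \<open>At each t, the distance between \<open>g m\<close> and \<open>g n\<close> is a
    limit of distances between \<open>f m\<close> and \<open>f n\<close> at translated points, so
    their uniform bound passes over. It is taken as e/2 because strictness is lost in the
    limit.\<close>
  have "uniformly_Cauchy_on UNIV g"
  proof (rule uniformly_Cauchy_onI)
    fix e :: real assume "e > 0"
    have "uniformly_Cauchy_on UNIV f"
      using lim by (intro uniformly_convergent_Cauchy) (auto simp: uniformly_convergent_on_def)
    then obtain N where N: "\<And>t m n. m \<ge> N \<Longrightarrow> n \<ge> N \<Longrightarrow> dist (f m t) (f n t) < e/2"
      using \<open>e > 0\<close> unfolding uniformly_Cauchy_on_def by (meson UNIV_I half_gt_zero)
    have "dist (g m t) (g n t) < e" if "m \<ge> N" "n \<ge> N" for m n t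
    proof -
      have "(\<lambda>k. dist (f m (t + ?s k)) (f n (t + ?s k))) \<longlonglongrightarrow> dist (g m t) (g n t)"
        using g[of m] g[of n] by (intro tendsto_dist) (auto simp: aa_along_def)
      then have "dist (g m t) (g n t) \<le> e/2"
        using N[OF that] by (intro LIMSEQ_le_const2) (auto intro: less_imp_le)
      then show ?thesis using \<open>e > 0\<close> by linarith
    qed
    then show "\<exists>M. \<forall>t\<in>UNIV. \<forall>m\<ge>M. \<forall>n\<ge>M. dist (g m t) (g n t) < e" by blast
  qed
  then obtain h where h: "uniform_limit UNIV g h sequentially"
    using Cauchy_uniformly_convergent unfolding uniformly_convergent_on_def by blast
  have "(\<lambda>k. l (t + ?s k)) \<longlonglongrightarrow> h t" for t
  proof (rule swap_uniform_limit')
    show "\<forall>\<^sub>F n in sequentially. ((\<lambda>k. f n (t + ?s k)) \<longlonglongrightarrow> g n t)"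
      using g by (simp add: aa_along_def)
    show "uniform_limit UNIV (\<lambda>n k. f n (t + ?s k)) (\<lambda>k. l (t + ?s k)) sequentially"
      using lim by (rule uniform_limit_reindex)
    show "(\<lambda>n. g n t) \<longlonglongrightarrow> h t"
      using h by (rule tendsto_uniform_limitI) simp
  qed simp_all
  \<comment> \<open>Here the approximants \<open>g n\<close> are evaluated at points moving with k,
    so pointwise convergence to \<open>h\<close> would not suffice for the interchange.\<close>
  moreover have "(\<lambda>k. h (t - ?s k)) \<longlonglongrightarrow> l t" for t
  proof (rule swap_uniform_limit')
    show "\<forall>\<^sub>F n in sequentially. ((\<lambda>k. g n (t - ?s k)) \<longlonglongrightarrow> f n t)"
      using g by (simp add: aa_along_def)
    show "uniform_limit UNIV (\<lambda>n k. g n (t - ?s k)) (\<lambda>k. h (t - ?s k)) sequentially"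
      using h by (rule uniform_limit_reindex)
    show "(\<lambda>n. f n t) \<longlonglongrightarrow> l t"
      using lim by (rule tendsto_uniform_limitI) simp
  qed simp_all
  ultimately have "aa_along ?s l h" by (simp add: aa_along_def)
  then show "\<exists>\<sigma>. strict_mono \<sigma> \<and> (\<exists>h. aa_along (s \<circ> \<sigma>) l h)"
    using subseq_diagseq by blast
qed

lemma subspace_AA: "subspace {f :: real \<Rightarrow>\<^sub>C 'a::real_normed_vector. apply_bcontfun f \<in> AA}"
  unfolding subspace_def
proof (intro conjI allI ballI)
  show "0 \<in> {f :: real \<Rightarrow>\<^sub>C 'a. apply_bcontfun f \<in> AA}"
    using AA_const[of 0] by simp
next
  fix x y :: "real \<Rightarrow>\<^sub>C 'a"
  assume "x \<in> {f. apply_bcontfun f \<in> AA}" "y \<in> {f. apply_bcontfun f \<in> AA}"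
  then show "x + y \<in> {f. apply_bcontfun f \<in> AA}"
    using AA_add[of x y] by simp
next
  fix c and x :: "real \<Rightarrow>\<^sub>C 'a"
  assume "x \<in> {f. apply_bcontfun f \<in> AA}"
  then show "c *\<^sub>R x \<in> {f. apply_bcontfun f \<in> AA}"
    using AA_compose[of x "\<lambda>z. c *\<^sub>R z"] by (simp add: continuous_on_scaleR)
qed

lemma closed_AA: "closed {f :: real \<Rightarrow>\<^sub>C 'a::banach. apply_bcontfun f \<in> AA}"
  unfolding closed_sequential_limits
  by (auto intro: AA_uniform_limit tendsto_bcontfun_uniform_limit)

section \<open>Ergodic functions\<close>

definition mean :: "real measure \<Rightarrow> real \<Rightarrow> (real \<Rightarrow> 'a::real_normed_vector) \<Rightarrow> real" where
  "mean M r f = (1 / measure M {-r..r}) * (LINT t:{-r..r}|M. norm (f t))"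

lemma ergodic_iff: "f \<in> ergodic M \<longleftrightarrow> f \<in> bcontfun \<and> ((\<lambda>r. mean M r f) \<longlongrightarrow> 0) at_top"
  by (simp add: ergodic_def mean_def)

lemma mean_nonneg: "0 \<le> mean M r f"
  by (auto simp: mean_def set_lebesgue_integral_def intro!: integral_nonneg_AE divide_nonneg_nonneg)

lemma mean_scaleR: "mean M r (\<lambda>t. c *\<^sub>R f t) = \<bar>c\<bar> * mean M r f"
  by (simp add: mean_def)

lemma set_integrable_norm_bcontfun:
  assumes M: "M \<in> measure_class" and f: "f \<in> bcontfun"
  shows "set_integrable M {-r..r} (\<lambda>t. norm (f t))"
proof -
  \<comment> \<open>For negative \<open>r\<close> the interval is empty and the finiteness condition
    of \<open>measure_class\<close> says nothing, hence the case split.\<close>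
  have sets: "sets M = sets lebesgue" and fin: "emeasure M {-r..r} < \<infinity>"
    using M by (cases "-r \<le> r"; auto simp: measure_class_def)+
  from f obtain K where K: "\<And>t. norm (f t) \<le> K"
    by (auto simp: bcontfun_def bounded_iff)
  \<comment> \<open>Measurability travels from the Borel sets to their Lebesgue completion and then
    to \<open>M\<close>, which has the same measurable sets.\<close>
  have "(\<lambda>t. norm (f t)) \<in> borel_measurable borel"
    using f by (intro borel_measurable_continuous_onI continuous_on_norm) (simp add: bcontfun_def)
  then have "(\<lambda>t. norm (f t)) \<in> borel_measurable lebesgue"
    by (intro measurable_completion) simp
  then have meas: "(\<lambda>t. norm (f t)) \<in> borel_measurable M"
    by (simp add: measurable_cong_sets[OF sets refl])
  have "{-r..r} \<in> sets M" by (simp add: sets)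
  then show ?thesis
    unfolding set_integrable_def
    using fin meas K
    by (intro integrableI_bounded_set_indicator[where B=K]) auto
qed

text \<open>Equality fails for nonzero \<open>c\<close> when the interval has measure 0, since the
  mean is then 0 by division by zero. The inequality holds for every \<open>r\<close>.\<close>

lemma mean_const_le:
  assumes M: "M \<in> measure_class"
  shows "mean M r (\<lambda>t. c) \<le> norm c"
proof -
  have "{-r..r} \<in> sets M" "emeasure M {-r..r} < \<infinity>"
    using M by (cases "-r \<le> r"; auto simp: measure_class_def)+
  then have "(LINT t:{-r..r}|M. norm c) = measure M {-r..r} * norm c"
    by (simp add: set_lebesgue_integral_def)
  then show ?thesis by (simp add: mean_def)
qed

lemma mean_triangle:
  assumes M: "M \<in> measure_class" and "f \<in> bcontfun" "g \<in> bcontfun" "h \<in> bcontfun"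
    and le: "\<And>t. norm (f t) \<le> norm (g t) + norm (h t)"
  shows "mean M r f \<le> mean M r g + mean M r h"
proof -
  note int = set_integrable_norm_bcontfun[OF M]
  have "(LINT t:{-r..r}|M. norm (f t)) \<le> (LINT t:{-r..r}|M. norm (g t) + norm (h t))"
    using assms by (intro set_integral_mono set_integral_add int)
  also have "\<dots> = (LINT t:{-r..r}|M. norm (g t)) + (LINT t:{-r..r}|M. norm (h t))"
    using assms by (intro set_integral_add int)
  finally show ?thesis
    unfolding mean_def distrib_left[symmetric] by (rule mult_left_mono) simp
qed

text \<open>Two dominating functions cover sums of ergodic functions as well as the remainder after
  truncation, where the same function is used twice.\<close>

lemma ergodic_triangle:
  assumes M: "M \<in> measure_class" and f: "f \<in> bcontfun" and g: "g \<in> ergodic M" and h: "h \<in> ergodic M"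
    and le: "\<And>t. norm (f t) \<le> norm (g t) + norm (h t)"
  shows "f \<in> ergodic M"
proof -
  have "((\<lambda>r. mean M r g + mean M r h) \<longlongrightarrow> 0 + 0) at_top"
    using g h by (intro tendsto_add) (auto simp: ergodic_iff)
  then have lim: "((\<lambda>r. mean M r g + mean M r h) \<longlongrightarrow> 0) at_top" by simp
  have "mean M r f \<le> mean M r g + mean M r h" for r
    using g h by (intro mean_triangle[OF M f _ _ le]) (simp_all add: ergodic_iff)
  then have "norm (mean M r f) \<le> mean M r g + mean M r h" for r
    using mean_nonneg[of M r f] by simp
  then have "((\<lambda>r. mean M r f) \<longlongrightarrow> 0) at_top"
    by (intro Lim_null_comparison[OF _ lim] always_eventually allI)
  then show ?thesis using f by (simp add: ergodic_iff)
qed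

lemma ergodic_zero: "(\<lambda>t. 0) \<in> ergodic M"
  by (simp add: ergodic_iff const_bcontfun mean_def)

lemma subspace_ergodic:
  assumes M: "M \<in> measure_class"
  shows "subspace {f :: real \<Rightarrow>\<^sub>C 'a::real_normed_vector. apply_bcontfun f \<in> ergodic M}"
  unfolding subspace_def
proof (intro conjI allI ballI)
  show "0 \<in> {f :: real \<Rightarrow>\<^sub>C 'a. apply_bcontfun f \<in> ergodic M}"
    using ergodic_zero by simp
next
  fix x y :: "real \<Rightarrow>\<^sub>C 'a"
  assume "x \<in> {f. apply_bcontfun f \<in> ergodic M}" "y \<in> {f. apply_bcontfun f \<in> ergodic M}"
  then show "x + y \<in> {f. apply_bcontfun f \<in> ergodic M}"
    using ergodic_triangle[OF M apply_bcontfun, of x y "x + y"] by (simp add: norm_triangle_ineq)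
next
  fix c and x :: "real \<Rightarrow>\<^sub>C 'a"
  assume "x \<in> {f. apply_bcontfun f \<in> ergodic M}"
  then have "((\<lambda>r. \<bar>c\<bar> * mean M r x) \<longlongrightarrow> 0) at_top"
    by (auto simp: ergodic_iff intro: tendsto_mult_right_zero)
  then show "c *\<^sub>R x \<in> {f. apply_bcontfun f \<in> ergodic M}"
    using apply_bcontfun[of "c *\<^sub>R x"] by (simp add: ergodic_iff mean_scaleR)
qed

lemma closed_ergodic:
  assumes M: "M \<in> measure_class"
  shows "closed {f :: real \<Rightarrow>\<^sub>C 'a::real_normed_vector. apply_bcontfun f \<in> ergodic M}"
  unfolding closed_sequential_limits
proof (intro allI impI, elim conjE, intro CollectI)
  fix f :: "nat \<Rightarrow> real \<Rightarrow>\<^sub>C 'a" and l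
  assume f: "\<forall>n. f n \<in> {f. apply_bcontfun f \<in> ergodic M}" and lim: "f \<longlonglongrightarrow> l"
  have "((\<lambda>r. mean M r l) \<longlongrightarrow> 0) at_top"
  proof (rule tendstoI)
    fix e :: real assume "e > 0"
    then obtain n where n: "dist (f n) l < e/2"
      using metric_LIMSEQ_D[OF lim, of "e/2"] by auto
    have "((\<lambda>r. mean M r (f n)) \<longlongrightarrow> 0) at_top"
      using f by (simp add: ergodic_iff)
    then have "\<forall>\<^sub>F r in at_top. dist (mean M r (f n)) 0 < e/2"
      using \<open>e > 0\<close> by (intro tendstoD) auto
    then show "\<forall>\<^sub>F r in at_top. dist (mean M r l) 0 < e"
    proof eventually_elim
      case (elim r)
      \<comment> \<open>The uniform error is treated as the constant function e/2. That function is
        not ergodic, so the comparison is made at the level of means, for each \<open>r\<close>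
        separately.\<close>
      have "norm (l t) \<le> norm (f n t) + norm (e/2)" for t
      proof -
        have "norm (l t) \<le> norm (f n t) + dist (f n t) (l t)"
          by (metis dist_commute dist_norm norm_triangle_sub)
        then show ?thesis using dist_bounded[of "f n" t l] n by simp
      qed
      then have "norm (l t) \<le> norm (f n t) + norm (e/2)" for t .
      then have "mean M r l \<le> mean M r (f n) + mean M r (\<lambda>t. e/2)"
        by (intro mean_triangle[OF M]) (auto simp: apply_bcontfun const_bcontfun)
      also have "\<dots> < e/2 + norm (e/2)"
        using elim mean_const_le[OF M, of r "e/2"] by simp
      finally show ?case using \<open>e > 0\<close> mean_nonneg[of M r l] by simp
    qed
  qed
  then show "apply_bcontfun l \<in> ergodic M"
    by (simp add: ergodic_iff apply_bcontfun)
qed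

text \<open>The lemma on closed sums is applied in this type and asks for a Banach space.\<close>

instance bcontfun :: (metric_space, banach) banach ..

section \<open>Truncation and completeness\<close>

text \<open>\<open>PAA\<close> quantifies over plain functions. Both summands lift to bounded
  continuous functions, the almost automorphic one by \<open>AA_bcontfun\<close> and the ergodic one
  by definition.\<close>

lemma PAA_eq_sum:
  "PAA M = {x + y |x y. x \<in> {f. apply_bcontfun f \<in> AA} \<and> y \<in> {f. apply_bcontfun f \<in> ergodic M}}"
  (is "_ = ?S")
proof (intro equalityI subsetI)
  fix f :: "real \<Rightarrow>\<^sub>C 'a"
  assume "f \<in> PAA M"
  then obtain g \<phi> where *: "g \<in> AA" "\<phi> \<in> ergodic M" "apply_bcontfun f = (\<lambda>t. g t + \<phi> t)"
    by (auto simp: PAA_def)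
  obtain x where x: "g = apply_bcontfun x"
    using AA_bcontfun[OF *(1)] by (rule bcontfunE)
  obtain y where y: "\<phi> = apply_bcontfun y"
    using *(2) by (auto simp: ergodic_def elim: bcontfunE)
  have "f = x + y" using * x y by (intro bcontfun_eqI) simp
  then show "f \<in> ?S" using * x y by blast
next
  fix f :: "real \<Rightarrow>\<^sub>C 'a"
  assume "f \<in> ?S"
  then obtain x y where "apply_bcontfun x \<in> AA" "apply_bcontfun y \<in> ergodic M" "f = x + y"
    by blast
  then show "f \<in> PAA M" unfolding PAA_def by (intro CollectI exI conjI) auto
qed

lemma PAA_decomposition:
  fixes f :: "real \<Rightarrow>\<^sub>C 'a::real_normed_vector"
  assumes M: "M \<in> measure_class" and f: "f \<in> PAA M"
  shows "\<exists>g. apply_bcontfun g \<in> AA \<and> apply_bcontfun (f - g) \<in> ergodic M \<and> norm g \<le> norm f"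
proof (cases "f = 0")
  \<comment> \<open>Radius 0 would put a zero in the denominator of the truncation; here 0 + 0 is
    the decomposition.\<close>
  case True
  then show ?thesis
    by (intro exI[of _ 0]) (simp add: AA_const ergodic_zero)
next
  case False
  define c where "c = norm f"
  have c: "c > 0" using False by (simp add: c_def)
  \<comment> \<open>The maximum makes one formula serve inside the ball, where the factor is 1, and
    outside, where it rescales to norm \<open>c\<close>. It also keeps the denominator positive,
    which gives continuity.\<close>
  define T :: "'a \<Rightarrow> 'a" where "T x = (c / max c (norm x)) *\<^sub>R x" for x
  have "continuous_on UNIV T"
    unfolding T_def using c by (intro continuous_intros) (auto simp: max_def)
  have T_le: "norm (T x) \<le> c" for x
    using c by (auto simp: T_def max_def field_simps)
  have T_diff: "norm (x - T x) = max 0 (norm x - c)" for x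
  proof (cases "norm x \<le> c")
    case True
    then show ?thesis using c by (simp add: T_def max_def)
  next
    case False
    then have "x - T x = (1 - c / norm x) *\<^sub>R x" by (simp add: T_def max_def algebra_simps)
    then have "norm (x - T x) = \<bar>1 - c / norm x\<bar> * norm x" by simp
    also have "\<bar>1 - c / norm x\<bar> = 1 - c / norm x"
      using False c by (intro abs_of_nonneg) (simp add: divide_le_eq_1)
    also have "\<dots> * norm x = norm x - c"
      using False c by (auto simp: left_diff_distrib)
    finally show ?thesis using False by simp
  qed
  obtain x y where xy: "apply_bcontfun x \<in> AA" "apply_bcontfun y \<in> ergodic M" "f = x + y"
    using f unfolding PAA_eq_sum by blast
  have TAA: "(\<lambda>t. T (x t)) \<in> AA"
    using xy(1) \<open>continuous_on UNIV T\<close> by (rule AA_compose)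
  obtain g where g: "(\<lambda>t. T (x t)) = apply_bcontfun g"
    using AA_bcontfun[OF TAA] by (rule bcontfunE)
  have gt: "g t = T (x t)" for t using fun_cong[OF g, of t] by simp
  \<comment> \<open>\<open>f - g\<close> is the truncation error of \<open>x\<close> plus
    \<open>y\<close>. The error is the excess of norm (\<open>x t\<close>) over \<open>c\<close>, at
    most norm (\<open>y t\<close>) because norm (\<open>f t\<close>) is at most \<open>c\<close>; so
    \<open>y\<close> counts twice.\<close>
  have "norm ((f - g) t) \<le> norm (y t) + norm (y t)" for t
  proof -
    have "x t + y t = f t" by (simp add: xy(3))
    then have "norm (x t) \<le> norm (f t) + norm (y t)"
      by (metis add_diff_cancel_right' norm_triangle_ineq4)
    then have "norm (x t) - c \<le> norm (y t)"
      using norm_bounded[of f t] by (simp add: c_def)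
    then have "norm (x t - T (x t)) \<le> norm (y t)"
      by (simp add: T_diff)
    moreover have "(f - g) t = (x t - T (x t)) + y t"
      by (simp add: xy(3) gt)
    ultimately show ?thesis
      using norm_triangle_ineq[of "x t - T (x t)" "y t"] by simp
  qed
  then have "apply_bcontfun (f - g) \<in> ergodic M"
    using xy(2) by (intro ergodic_triangle[OF M apply_bcontfun])
  moreover have "norm g \<le> norm f"
    using T_le by (intro norm_bound) (simp add: gt c_def)
  ultimately show ?thesis using TAA unfolding g by blast
qed

theorem theorem5p11:
  fixes M :: "real measure"
  assumes "M \<in> measure_class"
  shows "subspace (PAA M :: (real \<Rightarrow>\<^sub>C 'a::banach) set) \<and>
    complete (PAA M :: (real \<Rightarrow>\<^sub>C 'a) set)"
  \<comment> \<open>The ambient space of bounded continuous functions is complete, so completeness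
    of a subset amounts to closedness.\<close>
  unfolding complete_eq_closed PAA_eq_sum
proof
  show "subspace {x + y |x y. x \<in> {f :: real \<Rightarrow>\<^sub>C 'a. apply_bcontfun f \<in> AA} \<and>
      y \<in> {f. apply_bcontfun f \<in> ergodic M}}"
    using subspace_AA subspace_ergodic[OF assms] by (rule subspace_sums)
  show "closed {x + y |x y. x \<in> {f :: real \<Rightarrow>\<^sub>C 'a. apply_bcontfun f \<in> AA} \<and>
      y \<in> {f. apply_bcontfun f \<in> ergodic M}}"
    using subspace_AA closed_AA subspace_ergodic[OF assms] closed_ergodic[OF assms]
  proof (rule closed_sum_of_closed_subspaces)
    fix f :: "real \<Rightarrow>\<^sub>C 'a"
    assume "f \<in> {x + y |x y. x \<in> {f. apply_bcontfun f \<in> AA} \<and> y \<in> {f. apply_bcontfun f \<in> ergodic M}}"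
    then show "\<exists>g\<in>{f. apply_bcontfun f \<in> AA}. f - g \<in> {f. apply_bcontfun f \<in> ergodic M} \<and> norm g \<le> norm f"
      using PAA_decomposition[OF assms, of f] unfolding PAA_eq_sum by blast
  qed
qed

end
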